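(* Let $X$ be a real Banach space with norm $|\cdot|$ and dual $X^{*}$, whose duality mapping $J$ (corresponding to some normalization function) is single-valued, strictly monotone and invertible as a map $J\colon X\to X^{*}$, with continuous inverse $J^{-1}$. Let $K\subset X$ be a nondegenerate cone, let $E\colon X\to\mathbb{R}$ be a $C^{1}$ Fréchet differentiable functional, and let $0<r<R<\infty$. Put $$K_{r,R}=\{u\in K: r\le |u|\le R\},\qquad \mathcal{N}_{r,R}=\{u\in K_{r,R}: \langle E'(u),u\rangle=0\},$$ $$N\colon X\to X^{*},\quad N(u)=J(u)-E'(u),\qquad T\colon X\to X,\quad T=J^{-1}N,$$ and for $u\in K\setminus\{0\}$ let $\alpha_u\colon\mathbb{R}_+\to\mathbb{R}$, $\alpha_u(s)=E(su)$, so that $\alpha_u'(s)=\langle E'(su),u\rangle$. Assume that: (H1) $T$ is completely continuous from $X$ to $X$ and $T(K)\subset K$; (H2) $\inf_{u\in\mathcal{N}_{r,R}}|T(u)|>0$; (H3) for every $u\in K_{r,R}$ one has $\alpha_u'\left(\frac{r}{|u|}\right)>0$, $\alpha_u'\left(\frac{R}{|u|}\right)<0$, and the equation $\alpha_u'(s)=0$ has a unique solution $s=s(u)$ in the interval $\left[\frac{r}{|u|},\frac{R}{|u|}\right]$. Then there exists $u^{*}\in\mathcal{N}_{r,R}$ such that $E'(u^{*})=0$.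
   Context: $\langle\cdot,\cdot\rangle$ denotes the dual pairing between $X^{*}$ and $X$, and $\mathbb{R}_+=[0,\infty)$. A normalization function is a continuous strictly increasing function $\varphi\colon\mathbb{R}_+\to\mathbb{R}_+$ with $\varphi(0)=0$ and $\varphi(\tau)\to\infty$ as $\tau\to\infty$. The duality mapping corresponding to $\varphi$ is the set-valued map $J\colon X\to 2^{X^{*}}$, $J(x)=\{x^{*}\in X^{*}: \langle x^{*},x\rangle=\varphi(|x|)|x|,\ |x^{*}|_{X^{*}}=\varphi(|x|)\}$; when it is single-valued it is identified with a map $X\to X^{*}$. Strictly monotone means $\langle J(x)-J(y),x-y\rangle>0$ for all $x\ne y$. A nondegenerate cone in $X$ is a closed convex set $K\subset X$ with $\lambda K\subset K$ for all $\lambda\in\mathbb{R}_+$ and $K\setminus\{0\}\neq\emptyset$. Completely continuous means continuous and mapping bounded sets into relatively compact sets. *)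

theory Defs
  imports "HOL-Analysis.Analysis"
begin

text \<open>
  The dual of a real Banach space \<open>'a\<close> is the Banach space \<open>'a \<Rightarrow>\<^sub>L real\<close> of bounded linear
  functionals with the operator norm; the pairing of \<open>f\<close> and \<open>x\<close> is \<open>blinfun_apply f x\<close>.
\<close>

text \<open>Only the restriction of \<open>\<phi>\<close> to the nonnegative reals matters.\<close>

definition normalization_function :: "(real \<Rightarrow> real) \<Rightarrow> bool" where
  "normalization_function \<phi> \<longleftrightarrow>
     continuous_on {0..} \<phi> \<and> strict_mono_on {0..} \<phi> \<and> \<phi> ` {0..} \<subseteq> {0..} \<and>
     \<phi> 0 = 0 \<and> filterlim \<phi> at_top at_top"

definition duality_mapping ::
    "(real \<Rightarrow> real) \<Rightarrow> 'a::real_normed_vector \<Rightarrow> ('a \<Rightarrow>\<^sub>L real) set" where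
  "duality_mapping \<phi> x =
     {f. blinfun_apply f x = \<phi> (norm x) * norm x \<and> norm f = \<phi> (norm x)}"

definition strictly_monotone :: "('a::real_normed_vector \<Rightarrow> ('a \<Rightarrow>\<^sub>L real)) \<Rightarrow> bool" where
  "strictly_monotone J \<longleftrightarrow> (\<forall>x y. x \<noteq> y \<longrightarrow> blinfun_apply (J x - J y) (x - y) > 0)"

text \<open>Pointedness of the cone is not required, so \<open>K\<close> may contain lines.\<close>

definition nondegenerate_cone :: "'a::real_normed_vector set \<Rightarrow> bool" where
  "nondegenerate_cone K \<longleftrightarrow> closed K \<and> convex K \<and> cone K \<and> K - {0} \<noteq> {}"

definition completely_continuous ::
    "('a::real_normed_vector \<Rightarrow> 'b::real_normed_vector) \<Rightarrow> bool" where
  "completely_continuous T \<longleftrightarrow>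
     continuous_on UNIV T \<and> (\<forall>B. bounded B \<longrightarrow> compact (closure (T ` B)))"

definition conical_shell :: "'a::real_normed_vector set \<Rightarrow> real \<Rightarrow> real \<Rightarrow> 'a set" where
  "conical_shell K r R = {u \<in> K. r \<le> norm u \<and> norm u \<le> R}"

definition nehari_set ::
    "('a::real_normed_vector \<Rightarrow> ('a \<Rightarrow>\<^sub>L real)) \<Rightarrow> 'a set \<Rightarrow> real \<Rightarrow> real \<Rightarrow> 'a set" where
  "nehari_set E' K r R = {u \<in> conical_shell K r R. blinfun_apply (E' u) u = 0}"

definition N_operator ::
    "('a::real_normed_vector \<Rightarrow> ('a \<Rightarrow>\<^sub>L real)) \<Rightarrow> ('a \<Rightarrow> ('a \<Rightarrow>\<^sub>L real)) \<Rightarrow> 'a \<Rightarrow> ('a \<Rightarrow>\<^sub>L real)" where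
  "N_operator J E' u = J u - E' u"

definition T_operator ::
    "('a::real_normed_vector \<Rightarrow> ('a \<Rightarrow>\<^sub>L real)) \<Rightarrow> ('a \<Rightarrow> ('a \<Rightarrow>\<^sub>L real)) \<Rightarrow> 'a \<Rightarrow> 'a" where
  "T_operator J E' u = inv J (N_operator J E' u)"

text \<open>
  The functional along the ray through \<open>u\<close>. It is used only near arguments \<open>s > 0\<close>, so taking
  all real \<open>s\<close> instead of \<open>s \<ge> 0\<close> does not affect its derivative there.
\<close>

definition fibering_map :: "('a::real_normed_vector \<Rightarrow> real) \<Rightarrow> 'a \<Rightarrow> real \<Rightarrow> real" where
  "fibering_map E u s = E (s *\<^sub>R u)"

lemma deriv_fibering_map:
  fixes E :: "'a::real_normed_vector \<Rightarrow> real" and E' :: "'a \<Rightarrow> ('a \<Rightarrow>\<^sub>L real)"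
  assumes "\<And>v. (E has_derivative blinfun_apply (E' v)) (at v)"
  shows "deriv (fibering_map E u) s = blinfun_apply (E' (s *\<^sub>R u)) u"
proof -
  have "((\<lambda>s. s *\<^sub>R u) has_derivative (\<lambda>h. h *\<^sub>R u)) (at s)"
    by (auto intro!: derivative_eq_intros)
  from has_derivative_compose[OF this assms]
  have "((\<lambda>s. E (s *\<^sub>R u)) has_derivative (\<lambda>h. h * blinfun_apply (E' (s *\<^sub>R u)) u)) (at s)"
    by (simp add: blinfun.scaleR_right)
  then have "(fibering_map E u has_field_derivative blinfun_apply (E' (s *\<^sub>R u)) u) (at s)"
    by (simp add: has_field_derivative_def fibering_map_def[abs_def] mult.commute[of _ "blinfun_apply _ _"])
  then show ?thesis
    by (rule DERIV_imp_deriv)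
qed

end

theory Submission imports Defs begin

text \<open>
  Let \<open>S\<close> be the unit sphere of the cone \<open>K\<close>. On each ray through \<open>v \<in> S\<close> the hypothesis on the
  fibering maps singles out one radius \<open>s v\<close> strictly between \<open>r\<close> and \<open>R\<close> with \<open>s v *\<^sub>R v\<close> in the
  Nehari set; \<open>s\<close> is continuous because the derivative along the ray changes sign there
  (\<open>continuous_on_transversal_zero\<close>). Thus \<open>v \<mapsto> s v *\<^sub>R v\<close> parametrizes the Nehari set by \<open>S\<close>.

  It suffices to find \<open>u\<close> in the Nehari set with \<open>E' u (T u) \<ge> 0\<close>: since \<open>J (T u) = J u - E' u\<close>
  and \<open>E' u u = 0\<close>, the pairing of \<open>J u - J (T u)\<close> with \<open>u - T u\<close> is \<open>- E' u (T u) \<le> 0\<close>, so strict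
  monotonicity forces \<open>T u = u\<close>, that is \<open>E' u = 0\<close> (\<open>critical_point_if_nonneg_at_T\<close>).

  Such a \<open>u\<close> is found in two different ways. The obvious candidate is a fixed point of the
  normalized map \<open>g v = sgn (T (s v *\<^sub>R v))\<close> of \<open>S\<close> into itself, for which \<open>T u\<close> is a multiple of \<open>u\<close>
  and hence \<open>E' u (T u) = 0\<close>; the lower bound on \<open>T\<close> makes \<open>g\<close> well defined with relatively compact
  range. But when \<open>K\<close> is, say, a finite-dimensional subspace, \<open>S\<close> is a finite-dimensional sphere, and
  a continuous self-map of it may have no fixed point, as the antipodal map shows. The distinction
  that works is whether \<open>S\<close> is compact.

  If \<open>S\<close> is not compact, some \<open>h \<in> S\<close> has its antipode outside a given compact subset of \<open>S\<close>
  containing the range of \<open>g\<close>. Segments from \<open>h\<close> to that subset then avoid the origin, which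
  allows \<open>g\<close> to be extended to a compact map of the convex set \<open>K \<inter> cball 0 1\<close> into \<open>S\<close>, and
  Schauder's theorem yields the fixed point
  (\<open>noncompact_cone_sphere_fixed_point\<close>).

  If \<open>S\<close> is compact, \<open>v \<mapsto> E (s v *\<^sub>R v)\<close> attains a minimum. As \<open>E (s v *\<^sub>R v)\<close> is the maximum of
  \<open>E\<close> on the segment of the ray between the radii \<open>r\<close> and \<open>R\<close>, moving from the minimizer in a
  direction \<open>w \<in> K\<close> cannot decrease \<open>E\<close> to first order: \<open>E' u w \<ge> 0\<close> for all \<open>w \<in> K\<close>
  (\<open>minimax_stationary\<close>), in particular for \<open>w = T u\<close>.

  Schauder's theorem is obtained from a fixed point theorem for the Hilbert cube, which in turn
  follows from Kuhn's combinatorial lemma. The cube indexed by all natural numbers serves the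
  finite nets of all sizes in Schauder's argument at once, the surplus coordinates being \<open>0\<close>.
\<close>

section \<open>A fixed point theorem for the Hilbert cube\<close>

lemma tendsto_fun_coordinate:
  fixes X :: "nat \<Rightarrow> 'a \<Rightarrow> 'b::topological_space"
  assumes "X \<longlonglongrightarrow> x"
  shows "(\<lambda>n. X n i) \<longlonglongrightarrow> x i"
  using continuous_on_tendsto_compose[OF continuous_on_product_coordinates assms] by simp

lemma tendsto_fun_componentwise:
  fixes X :: "nat \<Rightarrow> 'a \<Rightarrow> 'b::topological_space"
  assumes "\<And>i. (\<lambda>n. X n i) \<longlonglongrightarrow> x i"
  shows "X \<longlonglongrightarrow> x"
  using assms limitin_componentwise[of "\<lambda>_. euclidean" UNIV X x sequentially]
  by (simp add: euclidean_product_topology)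

lemma compact_Hilbert_cube: "compact {x::nat \<Rightarrow> real. \<forall>i. x i \<in> {0..1}}"
proof -
  have "compactin (product_topology (\<lambda>i::nat. euclidean :: real topology) UNIV) (PiE UNIV (\<lambda>i. {0..1}))"
    by (simp add: compactin_PiE)
  moreover have "PiE UNIV (\<lambda>i. {0..1}) = {x::nat \<Rightarrow> real. \<forall>i. x i \<in> {0..1}}"
    by (auto simp: PiE_def Pi_def)
  ultimately show ?thesis
    by (simp add: euclidean_product_topology)
qed

text \<open>
  Kuhn's lemma is applied to the grid of mesh \<open>1 / p\<close> in the first \<open>n\<close> coordinates, all others being
  set to \<open>0\<close>. The label of a grid point records, for each coordinate, whether \<open>g\<close> moves the point
  up or down; a small cell on which all labels change is one where no coordinate is moved
  consistently in one direction.
\<close>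

lemma Kuhn_grid_approximation:
  fixes g :: "(nat \<Rightarrow> real) \<Rightarrow> nat \<Rightarrow> real"
  assumes g: "\<And>x. (\<forall>i. x i \<in> {0..1}) \<Longrightarrow> \<forall>i. g x i \<in> {0..1}"
    and p: "0 < p"
  shows "\<exists>z. (\<forall>i. z i \<in> {0..1}) \<and>
     (\<forall>i<n. \<exists>x y. (\<forall>j. x j \<in> {0..1} \<and> \<bar>x j - z j\<bar> \<le> 1 / real p) \<and>
                  (\<forall>j. y j \<in> {0..1} \<and> \<bar>y j - z j\<bar> \<le> 1 / real p) \<and>
                  x i \<le> g x i \<and> g y i \<le> y i)"
proof -
  define pt :: "(nat \<Rightarrow> nat) \<Rightarrow> nat \<Rightarrow> real" where
    "pt x = (\<lambda>i. if i < n then real (x i) / real p else 0)" for x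
  \<comment> \<open>On the face \<open>x i = p\<close> the label must be \<open>1\<close> even if \<open>g\<close> fixes that coordinate.\<close>
  define label :: "(nat \<Rightarrow> nat) \<Rightarrow> nat \<Rightarrow> nat" where
    "label x i = (if pt x i \<le> g (pt x) i \<and> x i \<noteq> p then 0 else 1)" for x i
  have pt: "\<forall>i. pt x i \<in> {0..1}" if "\<forall>i<n. x i \<le> p" for x
    using that p by (auto simp: pt_def)
  have l1: "\<forall>x. (\<forall>i<n. x i \<le> p) \<longrightarrow> (\<forall>i<n. label x i = (0::nat) \<or> label x i = 1)"
    by (auto simp: label_def)
  have l2: "\<forall>x. (\<forall>i<n. x i \<le> p) \<longrightarrow> (\<forall>i<n. x i = 0 \<longrightarrow> label x i = 0)"
  proof (intro allI impI)
    fix x i assume x: "\<forall>i<n. x i \<le> p" and i: "i < n" "x i = 0"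
    have "pt x i = 0" using i by (simp add: pt_def)
    then show "label x i = 0" using g[OF pt[OF x]] i p by (auto simp: label_def)
  qed
  have l3: "\<forall>x. (\<forall>i<n. x i \<le> p) \<longrightarrow> (\<forall>i<n. x i = p \<longrightarrow> label x i = 1)"
    by (auto simp: label_def)
  obtain q where q: "\<forall>i<n. q i < p"
    and rs: "\<forall>i<n. \<exists>r s. (\<forall>j<n. q j \<le> r j \<and> r j \<le> q j + 1) \<and>
       (\<forall>j<n. q j \<le> s j \<and> s j \<le> q j + 1) \<and> label r i \<noteq> label s i"
    by (rule kuhn_lemma[OF p l1 l2 l3])
  have near: "\<bar>pt r j - pt q j\<bar> \<le> 1 / real p" if "\<forall>j<n. q j \<le> r j \<and> r j \<le> q j + 1" for r j
  proof (cases "j < n")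
    case True
    then have "\<bar>real (r j) - real (q j)\<bar> \<le> 1" using that by force
    then show ?thesis using True p
      by (simp add: pt_def abs_divide divide_right_mono flip: diff_divide_distrib)
  qed (simp add: pt_def)
  show ?thesis
  proof (rule exI[of _ "pt q"], intro conjI allI impI)
    show "pt q i \<in> {0..1}" for i using pt[of q] q by (auto simp: less_imp_le)
    fix i assume i: "i < n"
    obtain r s where r: "\<forall>j<n. q j \<le> r j \<and> r j \<le> q j + 1"
      and s: "\<forall>j<n. q j \<le> s j \<and> s j \<le> q j + 1" and ne: "label r i \<noteq> label s i"
      using rs i by blast
    have "label r i = 0 \<and> label s i = 1 \<or> label s i = 0 \<and> label r i = 1"
      using ne unfolding label_def by presburger
    then obtain x y where x: "\<forall>j<n. q j \<le> x j \<and> x j \<le> q j + 1" and y: "\<forall>j<n. q j \<le> y j \<and> y j \<le> q j + 1"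
      and l: "label x i = 0" "label y i = 1"
      using r s by blast
    have "q j + 1 \<le> p" if "j < n" for j using q that by (simp add: Suc_leI)
    then have xp: "\<forall>j<n. x j \<le> p" and yp: "\<forall>j<n. y j \<le> p" using x y le_trans by blast+
    have "g (pt y) i \<le> pt y i"
    proof (cases "y i = p")
      case True
      then have "pt y i = 1" using i p by (simp add: pt_def)
      then show ?thesis using g[OF pt[OF yp]] by auto
    next
      case False
      then show ?thesis using l(2) by (auto simp: label_def split: if_splits)
    qed
    moreover have "pt x i \<le> g (pt x) i" using l(1) by (auto simp: label_def split: if_splits)
    ultimately
    show "\<exists>x y. (\<forall>j. x j \<in> {0..1} \<and> \<bar>x j - pt q j\<bar> \<le> 1 / real p) \<and>
                  (\<forall>j. y j \<in> {0..1} \<and> \<bar>y j - pt q j\<bar> \<le> 1 / real p) \<and>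
                  x i \<le> g x i \<and> g y i \<le> y i"
      using near[OF x] near[OF y] pt[OF xp] pt[OF yp] by blast
  qed
qed

text \<open>
  Dimension and fineness of the grid grow together. Along a subsequence the cells shrink to one
  point \<open>z\<close> in the product topology; each coordinate \<open>i\<close> is eventually covered by the grid, and both
  inequalities between \<open>g z i\<close> and \<open>z i\<close> survive in the limit.
\<close>

theorem Hilbert_cube_fixed_point:
  fixes g :: "(nat \<Rightarrow> real) \<Rightarrow> nat \<Rightarrow> real"
  defines "C \<equiv> {x. \<forall>i. x i \<in> {0..1}}"
  assumes cont: "continuous_on C g" and g: "g ` C \<subseteq> C"
  shows "\<exists>x\<in>C. g x = x"
proof -
  have "\<forall>n. \<exists>z. (\<forall>i. z i \<in> {0..1}) \<and>
     (\<forall>i<n. \<exists>x y. (\<forall>j. x j \<in> {0..1} \<and> \<bar>x j - z j\<bar> \<le> 1 / real (Suc n)) \<and>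
                  (\<forall>j. y j \<in> {0..1} \<and> \<bar>y j - z j\<bar> \<le> 1 / real (Suc n)) \<and>
                  x i \<le> g x i \<and> g y i \<le> y i)"
    using g by (intro allI Kuhn_grid_approximation) (auto simp: C_def)
  then obtain Z where ZC: "\<forall>n i. Z n i \<in> {0..1}"
    and Z: "\<forall>n. \<forall>i<n. \<exists>x y. (\<forall>j. x j \<in> {0..1} \<and> \<bar>x j - Z n j\<bar> \<le> 1 / real (Suc n)) \<and>
                  (\<forall>j. y j \<in> {0..1} \<and> \<bar>y j - Z n j\<bar> \<le> 1 / real (Suc n)) \<and>
                  x i \<le> g x i \<and> g y i \<le> y i"
    by metis
  have "seq_compact C" unfolding C_def by (rule compact_imp_seq_compact[OF compact_Hilbert_cube])
  then obtain z k where z: "z \<in> C" and k: "strict_mono (k :: nat \<Rightarrow> nat)" and lim: "(Z \<circ> k) \<longlonglongrightarrow> z"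
    using ZC unfolding seq_compact_def C_def by blast
  have lim_near: "X \<longlonglongrightarrow> z"
    if "\<forall>\<^sub>F n in sequentially. \<forall>j. \<bar>X n j - Z (k n) j\<bar> \<le> 1 / real (Suc (k n))" for X
  proof (rule tendsto_fun_componentwise)
    fix j
    have "(\<lambda>n. 1 / real (Suc (k n))) \<longlonglongrightarrow> 0"
      using LIMSEQ_subseq_LIMSEQ[OF LIMSEQ_Suc[OF lim_1_over_n] k] by (simp add: o_def)
    then have "(\<lambda>n. X n j - Z (k n) j) \<longlonglongrightarrow> 0"
      by (rule Lim_null_comparison[rotated]) (use that in \<open>auto elim: eventually_mono\<close>)
    from tendsto_add[OF this tendsto_fun_coordinate[OF lim, of j]]
    show "(\<lambda>n. X n j) \<longlonglongrightarrow> z j" by simp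
  qed
  have "g z i = z i" for i
  proof -
    have "\<forall>n. \<exists>x y. i < k n \<longrightarrow> (\<forall>j. x j \<in> {0..1} \<and> \<bar>x j - Z (k n) j\<bar> \<le> 1 / real (Suc (k n))) \<and>
                  (\<forall>j. y j \<in> {0..1} \<and> \<bar>y j - Z (k n) j\<bar> \<le> 1 / real (Suc (k n))) \<and>
                  x i \<le> g x i \<and> g y i \<le> y i"
      using Z by blast
    then obtain X Y where XY: "\<And>n. i < k n \<Longrightarrow>
          (\<forall>j. X n j \<in> {0..1} \<and> \<bar>X n j - Z (k n) j\<bar> \<le> 1 / real (Suc (k n))) \<and>
          (\<forall>j. Y n j \<in> {0..1} \<and> \<bar>Y n j - Z (k n) j\<bar> \<le> 1 / real (Suc (k n))) \<and>
          X n i \<le> g (X n) i \<and> g (Y n) i \<le> Y n i"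
      by metis
    have large: "\<forall>\<^sub>F n in sequentially. i < k n"
      using filterlim_subseq[OF k] eventually_gt_at_top[of i] by (rule eventually_compose_filterlim[rotated])
    have "\<forall>\<^sub>F n in sequentially. \<forall>j. \<bar>X n j - Z (k n) j\<bar> \<le> 1 / real (Suc (k n))"
      using large by eventually_elim (use XY in blast)
    then have X: "X \<longlonglongrightarrow> z" by (rule lim_near)
    have "\<forall>\<^sub>F n in sequentially. \<forall>j. \<bar>Y n j - Z (k n) j\<bar> \<le> 1 / real (Suc (k n))"
      using large by eventually_elim (use XY in blast)
    then have Y: "Y \<longlonglongrightarrow> z" by (rule lim_near)
    have XC: "\<forall>\<^sub>F n in sequentially. X n \<in> C"
      using large by eventually_elim (use XY in \<open>unfold C_def, blast\<close>)
    have YC: "\<forall>\<^sub>F n in sequentially. Y n \<in> C"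
      using large by eventually_elim (use XY in \<open>unfold C_def, blast\<close>)
    have gX: "(\<lambda>n. g (X n) i) \<longlonglongrightarrow> g z i"
      using tendsto_fun_coordinate[OF continuous_on_tendsto_compose[OF cont X z XC], of i] by simp
    have gY: "(\<lambda>n. g (Y n) i) \<longlonglongrightarrow> g z i"
      using tendsto_fun_coordinate[OF continuous_on_tendsto_compose[OF cont Y z YC], of i] by simp
    have "\<forall>\<^sub>F n in sequentially. X n i \<le> g (X n) i"
      using large by eventually_elim (use XY in blast)
    then have "z i \<le> g z i"
      by (rule tendsto_le[OF sequentially_bot gX tendsto_fun_coordinate[OF X, of i]])
    moreover have "\<forall>\<^sub>F n in sequentially. g (Y n) i \<le> Y n i"
      using large by eventually_elim (use XY in blast)
    then have "g z i \<le> z i"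
      by (rule tendsto_le[OF sequentially_bot tendsto_fun_coordinate[OF Y, of i] gY])
    ultimately show ?thesis by simp
  qed
  then show ?thesis using z by auto
qed

section \<open>Schauder's theorem\<close>

text \<open>
  The unknowns are the weights themselves: the cube is mapped to itself by reading off the weights
  of a convex combination. Arbitrary \<open>c\<close> in the cube have to be turned into convex
  coefficients \<open>a c\<close>; \<open>c\<close> is scaled down when its sum exceeds \<open>1\<close>, and any missing mass is
  given to \<open>p 0\<close>. At a fixed point the sum of \<open>c\<close> is \<open>1\<close>, so neither correction is active.
\<close>

lemma convex_combination_fixed_point:
  fixes D :: "'a::real_normed_vector set" and w :: "'a \<Rightarrow> nat \<Rightarrow> real"
  assumes "convex D" and p: "\<And>i. i < m \<Longrightarrow> p i \<in> D" and m: "0 < m"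
    and cont: "\<And>i. i < m \<Longrightarrow> continuous_on D (\<lambda>x. w x i)"
    and nonneg: "\<And>x i. x \<in> D \<Longrightarrow> i < m \<Longrightarrow> 0 \<le> w x i"
    and one: "\<And>x. x \<in> D \<Longrightarrow> (\<Sum>i<m. w x i) = 1"
  shows "\<exists>x\<in>D. x = (\<Sum>i<m. w x i *\<^sub>R p i)"
proof -
  define C where "C = {c :: nat \<Rightarrow> real. \<forall>i. c i \<in> {0..1}}"
  define a where "a c i = (c i + (if i = 0 then max 0 (1 - (\<Sum>j<m. c j)) else 0)) / max 1 (\<Sum>j<m. c j)"
    for c :: "nat \<Rightarrow> real" and i :: nat
  define \<Psi> where "\<Psi> c = (\<Sum>i<m. a c i *\<^sub>R p i)" for c
  have D: "\<Psi> c \<in> D" if "c \<in> C" for c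
    unfolding \<Psi>_def
  proof (rule convex_sum[OF _ \<open>convex D\<close>])
    have "(\<Sum>i<m. a c i) = ((\<Sum>i<m. c i) + max 0 (1 - (\<Sum>j<m. c j))) / max 1 (\<Sum>j<m. c j)"
      using m by (simp add: a_def sum.distrib sum.delta flip: sum_divide_distrib)
    also have "\<dots> = 1" by (auto simp: max_def)
    finally show "(\<Sum>i<m. a c i) = 1" .
    show "a c i \<ge> 0" if "i \<in> {..<m}" for i
      using \<open>c \<in> C\<close> by (auto simp: a_def C_def intro!: divide_nonneg_pos add_nonneg_nonneg)
  qed (use p in auto)
  have coord: "continuous_on C (\<lambda>c. c i)" for i
    by (rule continuous_on_subset[OF continuous_on_product_coordinates]) simp
  have \<Psi>_cont: "continuous_on C \<Psi>"
  proof -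
    have "continuous_on C (\<lambda>c. if i = 0 then max 0 (1 - (\<Sum>j<m. c j)) else 0)" for i :: nat
      by (cases "i = 0") (auto intro!: continuous_intros coord)
    then show ?thesis
      unfolding \<Psi>_def a_def by (intro continuous_intros coord) (auto simp: max_def)
  qed
  define g where "g c i = (if i < m then w (\<Psi> c) i else 0)" for c and i :: nat
  have "\<exists>c\<in>C. g c = c"
    unfolding C_def
  proof (rule Hilbert_cube_fixed_point, fold C_def)
    show "continuous_on C g"
    proof (rule continuous_on_coordinatewise_then_product)
      fix i
      show "continuous_on C (\<lambda>c. g c i)"
      proof (cases "i < m")
        case True
        then show ?thesis unfolding g_def
          using continuous_on_compose2[OF cont \<Psi>_cont] D by auto
      qed (simp add: g_def)
    qed
    show "g ` C \<subseteq> C"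
    proof safe
      fix c assume c: "c \<in> C"
      have "w (\<Psi> c) i \<le> 1" if "i < m" for i
        using member_le_sum[of i "{..<m}" "w (\<Psi> c)"] that nonneg[OF D[OF c]] one[OF D[OF c]] by auto
      then show "g c \<in> C" using nonneg[OF D[OF c]] by (auto simp: C_def g_def)
    qed
  qed
  then obtain c where c: "c \<in> C" "g c = c" by blast
  have ci: "c i = w (\<Psi> c) i" if "i < m" for i
    using fun_cong[OF c(2), of i] that by (simp add: g_def)
  have "(\<Sum>i<m. c i) = 1" using one[OF D[OF c(1)]] ci by simp
  then have "a c i = c i" for i by (simp add: a_def)
  then have "\<Psi> c = (\<Sum>i<m. c i *\<^sub>R p i)" by (simp add: \<Psi>_def)
  also have "\<dots> = (\<Sum>i<m. w (\<Psi> c) i *\<^sub>R p i)" by (intro sum.cong) (auto simp: ci)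
  finally have "\<Psi> c = (\<Sum>i<m. w (\<Psi> c) i *\<^sub>R p i)" .
  with D[OF c(1)] show ?thesis by blast
qed

text \<open>
  Schauder's projection: on an \<open>e\<close>-net \<open>p\<close> of \<open>Q\<close>, the weight of \<open>p i\<close> vanishes unless \<open>p i\<close> is
  within \<open>e\<close> of \<open>F x\<close>, so the weighted mean of the net differs from \<open>F x\<close> by at most \<open>e\<close>.
\<close>

lemma Schauder_approximate_fixed_point:
  fixes F :: "'a::real_normed_vector \<Rightarrow> 'a"
  assumes "convex D" "D \<noteq> {}" and cont: "continuous_on D F"
    and FQ: "F ` D \<subseteq> Q" and QD: "Q \<subseteq> D" and "compact Q" and e: "0 < e"
  shows "\<exists>x\<in>D. dist (F x) x \<le> e"
proof -
  obtain P where P: "finite P" "P \<subseteq> Q" "Q \<subseteq> (\<Union>x\<in>P. ball x e)"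
    using seq_compact_imp_totally_bounded[OF compact_imp_seq_compact[OF \<open>compact Q\<close>]] e by metis
  have "P \<noteq> {}" using P(3) FQ \<open>D \<noteq> {}\<close> by auto
  obtain p where p: "bij_betw p {..<card P} P"
    using ex_bij_betw_nat_finite[OF P(1)] atLeast0LessThan by auto
  define m where "m = card P"
  have pQ: "p i \<in> Q" if "i < m" for i
    using p P(2) that by (auto simp: bij_betw_def m_def)
  define \<mu> where "\<mu> y i = max 0 (e - dist y (p i))" for y i
  define w where "w x i = \<mu> (F x) i / (\<Sum>j<m. \<mu> (F x) j)" for x i
  have pos: "0 < (\<Sum>j<m. \<mu> (F x) j)" if x: "x \<in> D" for x
  proof -
    obtain y where "y \<in> P" "dist y (F x) < e" using P(3) FQ x by (auto simp: subset_iff)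
    moreover then obtain i where "i < m" "y = p i" using p by (auto simp: bij_betw_def m_def)
    ultimately have "i < m" "0 < \<mu> (F x) i" by (auto simp: \<mu>_def dist_commute)
    then show ?thesis by (intro sum_pos2[of _ i]) (auto simp: \<mu>_def)
  qed
  have w_nonneg: "0 \<le> w x i" if "x \<in> D" for x i
    using pos[OF that] by (auto simp: w_def \<mu>_def)
  have w_one: "(\<Sum>i<m. w x i) = 1" if "x \<in> D" for x
    using pos[OF that] by (simp add: w_def flip: sum_divide_distrib)
  have "\<exists>x\<in>D. x = (\<Sum>i<m. w x i *\<^sub>R p i)"
  proof (rule convex_combination_fixed_point[OF \<open>convex D\<close>])
    show "0 < m" using P(1) \<open>P \<noteq> {}\<close> by (simp add: m_def card_gt_0_iff)
    show "continuous_on D (\<lambda>x. w x i)" for i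
      unfolding w_def \<mu>_def
      by (intro continuous_intros cont ballI) (use pos in \<open>force simp: \<mu>_def\<close>)
  qed (use pQ QD w_nonneg w_one in auto)
  then obtain x where x: "x \<in> D" "x = (\<Sum>i<m. w x i *\<^sub>R p i)" by blast
  have bound: "norm (w x i *\<^sub>R (F x - p i)) \<le> w x i * e" for i
  proof (cases "dist (F x) (p i) < e")
    case True
    then show ?thesis using w_nonneg[OF x(1)] by (auto simp: dist_norm intro!: mult_left_mono)
  next
    case False
    then show ?thesis by (simp add: w_def \<mu>_def)
  qed
  have "F x - x = (\<Sum>i<m. w x i *\<^sub>R F x) - (\<Sum>i<m. w x i *\<^sub>R p i)"
    using w_one[OF x(1)] x(2) by (simp flip: scaleR_sum_left)
  also have "\<dots> = (\<Sum>i<m. w x i *\<^sub>R (F x - p i))"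
    by (simp add: scaleR_diff_right sum_subtractf)
  also have "norm \<dots> \<le> (\<Sum>i<m. w x i * e)"
    by (intro sum_norm_le bound)
  also have "\<dots> = e" using w_one[OF x(1)] by (simp flip: sum_distrib_right)
  finally show ?thesis using x(1) by (auto simp: dist_norm)
qed

theorem Schauder_fixed_point:
  fixes F :: "'a::real_normed_vector \<Rightarrow> 'a"
  assumes "convex D" "D \<noteq> {}" and cont: "continuous_on D F"
    and FQ: "F ` D \<subseteq> Q" and QD: "Q \<subseteq> D" and "compact Q"
  shows "\<exists>x\<in>Q. F x = x"
proof -
  have "\<forall>n. \<exists>x\<in>D. dist (F x) x \<le> 1 / real (Suc n)"
    using Schauder_approximate_fixed_point[OF assms] by simp
  then obtain X where X: "\<And>n. X n \<in> D" "\<And>n. dist (F (X n)) (X n) \<le> 1 / real (Suc n)"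
    by metis
  obtain x k where x: "x \<in> Q" and k: "strict_mono (k :: nat \<Rightarrow> nat)" and lim: "((\<lambda>n. F (X n)) \<circ> k) \<longlonglongrightarrow> x"
    using compact_imp_seq_compact[OF \<open>compact Q\<close>] X(1) FQ unfolding seq_compact_def
    by (metis image_subset_iff)
  have "(\<lambda>n. 1 / real (Suc (k n))) \<longlonglongrightarrow> 0"
    using LIMSEQ_subseq_LIMSEQ[OF LIMSEQ_Suc[OF lim_1_over_n] k] by (simp add: o_def)
  then have "(\<lambda>n. F (X (k n)) - X (k n)) \<longlonglongrightarrow> 0"
    by (rule Lim_null_comparison[rotated]) (use X(2) in \<open>auto simp: dist_norm\<close>)
  from tendsto_diff[OF lim this] have Xk: "(\<lambda>n. X (k n)) \<longlonglongrightarrow> x" by (simp add: o_def)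
  have "(\<lambda>n. F (X (k n))) \<longlonglongrightarrow> F x"
    using continuous_on_tendsto_compose[OF cont Xk] X(1) x QD by auto
  with lim have "F x = x" using LIMSEQ_unique by (auto simp: o_def)
  with x show ?thesis by blast
qed

section \<open>Self-maps of the unit sphere of a cone\<close>

text \<open>
  If every antipode of a point of \<open>S\<close> lay in \<open>Q\<close>, then \<open>S\<close> would be a closed subset of the compact
  set \<open>- Q\<close>. So there is \<open>h \<in> S\<close> with \<open>- h \<notin> Q\<close>, and \<open>(1 - t) *\<^sub>R h + t *\<^sub>R c\<close> with \<open>c \<in> Q\<close> never
  vanishes. The map \<open>g\<close> is extended to the unit ball of the cone by mixing its radial extension
  with \<open>h\<close>, with weight \<open>1 - norm x\<close> on \<open>h\<close>, and projecting to the sphere. All values have norm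
  \<open>1\<close>, so a fixed point lies on \<open>S\<close>, where the extension agrees with \<open>g\<close>.
\<close>

lemma noncompact_cone_sphere_fixed_point:
  fixes K :: "'a::real_normed_vector set" and g :: "'a \<Rightarrow> 'a"
  defines "S \<equiv> K \<inter> sphere 0 1"
  assumes K: "closed K" "convex K" "cone K"
    and cont: "continuous_on S g" and gQ: "g ` S \<subseteq> Q" and QS: "Q \<subseteq> S" and Q: "compact Q"
    and nc: "\<not> compact S"
  shows "\<exists>x\<in>S. g x = x"
proof -
  have closS: "closed S"
  proof -
    have "sphere 0 1 = {x::'a. norm x = 1}" by auto
    then have "closed (sphere (0::'a) 1)" by (simp add: closed_Collect_eq continuous_on_norm_id)
    with K(1) show ?thesis unfolding S_def by (rule closed_Int)
  qed
  have "\<not> S \<subseteq> uminus ` Q"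
  proof
    assume "S \<subseteq> uminus ` Q"
    moreover have "compact (uminus ` Q)" using Q by (intro compact_continuous_image continuous_intros)
    ultimately have "compact S" using closS closed_Int_compact[of S "uminus ` Q"] by (simp add: Int_absorb2)
    with nc show False by simp
  qed
  then obtain h where h: "h \<in> S" "h \<notin> uminus ` Q" by blast
  define D where "D = K \<inter> cball 0 1"
  define b where "b = (\<lambda>(t, c). (1 - t) *\<^sub>R h + t *\<^sub>R c)"
  have b_nz: "b (t, c) \<noteq> 0" if "t \<in> {0..1}" "c \<in> Q" for t c
  proof
    assume "b (t, c) = 0"
    then have eq: "(1 - t) *\<^sub>R h = - (t *\<^sub>R c)" by (simp add: b_def add_eq_0_iff2)
    then have "\<bar>1 - t\<bar> * norm h = \<bar>t\<bar> * norm c" by (metis norm_minus_cancel norm_scaleR)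
    moreover have "norm h = 1" "norm c = 1" using h QS that by (auto simp: S_def)
    ultimately have "t = 1/2" using that by auto
    with eq have "h = - c" by (simp flip: scaleR_minus_right)
    with h(2) that show False by blast
  qed
  have b_K: "b (t, c) \<in> K" if "t \<in> {0..1}" "c \<in> Q" for t c
    using K(2) h QS that unfolding b_def convex_alt by (auto simp: S_def)
  define Q' where "Q' = (sgn \<circ> b) ` ({0..1} \<times> Q)"
  have "continuous_on ({0..1} \<times> Q) b"
    unfolding b_def split_def by (intro continuous_intros)
  then have "continuous_on ({0..1} \<times> Q) (sgn \<circ> b)"
    unfolding o_def by (rule continuous_on_sgn) (use b_nz in force)
  then have Q': "compact Q'"
    unfolding Q'_def using Q by (intro compact_continuous_image compact_Times) auto
  have Q'S: "Q' \<subseteq> S"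
  proof
    fix y assume "y \<in> Q'"
    then obtain t c where tc: "t \<in> {0..1}" "c \<in> Q" "y = sgn (b (t, c))" by (auto simp: Q'_def)
    then show "y \<in> S" using b_nz b_K K(3) by (auto simp: S_def norm_sgn sgn_div_norm cone_def)
  qed
  have sgn_S: "sgn x \<in> S" if "x \<in> K" "x \<noteq> 0" for x
    using that K(3) by (auto simp: S_def norm_sgn sgn_div_norm cone_def)
  define G where "G x = norm x *\<^sub>R g (sgn x)" for x
  have norm_g: "norm (g v) = 1" if "v \<in> S" for v
  proof -
    have "g v \<in> S" using that gQ QS by blast
    then show ?thesis by (simp add: S_def)
  qed
  have norm_G: "norm (G x) = norm x" if "x \<in> K" for x
    using norm_g[OF sgn_S[OF that]] by (cases "x = 0") (simp_all add: G_def)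
  \<comment> \<open>Continuity at the origin comes from \<open>norm (G x) = norm x\<close>; elsewhere it is inherited from \<open>g\<close>.\<close>
  have contG: "continuous_on D G"
    unfolding continuous_on_eq_continuous_within
  proof
    fix x assume x: "x \<in> D"
    show "continuous (at x within D) G"
    proof (cases "x = 0")
      case True
      have "((\<lambda>y. norm (G y)) \<longlongrightarrow> 0) (at 0 within D)"
      proof (rule Lim_transform_eventually)
        show "(norm \<longlongrightarrow> 0) (at (0::'a) within D)" using tendsto_norm_zero tendsto_ident_at by blast
        show "\<forall>\<^sub>F y in at 0 within D. norm y = norm (G y)"
          using norm_G by (auto simp: eventually_at_filter D_def)
      qed
      then show ?thesis using True
        by (simp add: continuous_within G_def[of 0] tendsto_norm_zero_iff)
    next
      case False
      have "continuous_on (D - {0}) G"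
        unfolding G_def
        by (intro continuous_intros continuous_on_compose2[OF cont])
           (use sgn_S in \<open>auto simp: D_def\<close>)
      with x False have "continuous (at x within D - {0}) G"
        by (simp add: continuous_on_eq_continuous_within)
      moreover have "at x within D - {0} = at x within D"
      proof (rule at_within_nhd[of x "- {0}"])
      qed (use False in auto)
      ultimately show ?thesis by simp
    qed
  qed
  define F where "F x = sgn ((1 - norm x) *\<^sub>R h + G x)" for x
  have F_b: "(1 - norm x) *\<^sub>R h + G x \<in> b ` ({0..1} \<times> Q)" if "x \<in> D" for x
  proof (cases "x = 0")
    case True
    have "Q \<noteq> {}" using gQ h(1) by auto
    then obtain c where "c \<in> Q" by blast
    with True show ?thesis by (intro image_eqI[of _ _ "(0, c)"]) (auto simp: b_def G_def)
  next
    case False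
    with that have "g (sgn x) \<in> Q" using sgn_S gQ by (auto simp: D_def)
    with that show ?thesis
      by (intro image_eqI[of _ _ "(norm x, g (sgn x))"]) (auto simp: b_def G_def D_def)
  qed
  have "\<exists>x\<in>Q'. F x = x"
  proof (rule Schauder_fixed_point)
    show "convex D" using K(2) by (simp add: D_def convex_Int)
    show "D \<noteq> {}" using h(1) by (auto simp: D_def S_def)
    show "continuous_on D F" unfolding F_def
      by (intro continuous_on_sgn continuous_intros contG) (use F_b b_nz in fastforce)
    show "F ` D \<subseteq> Q'" using F_b by (fastforce simp: F_def Q'_def)
    show "Q' \<subseteq> D" using Q'S by (auto simp: S_def D_def)
  qed fact
  then obtain x where x: "x \<in> S" "F x = x" using Q'S by blast
  then have "norm x = 1" by (simp add: S_def)
  then have "sgn (g x) = x" using x by (simp add: F_def G_def sgn_div_norm)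
  then have "g x = x" using norm_g[OF x(1)] by (simp add: sgn_div_norm)
  with x show ?thesis by blast
qed

section \<open>The Nehari radius and the minimax principle\<close>

text \<open>
  By the intermediate value theorem \<open>f v\<close> is positive before its unique zero and negative after it.
  A strict sign at a fixed \<open>t\<close> persists for nearby \<open>v\<close>, so the zero of \<open>f v\<close>
  stays on the same side of \<open>t\<close>.
\<close>

lemma continuous_on_transversal_zero:
  fixes f :: "'a::topological_space \<Rightarrow> real \<Rightarrow> real" and s :: "'a \<Rightarrow> real"
  assumes f1: "\<And>t. t \<in> {a..b} \<Longrightarrow> continuous_on S (\<lambda>v. f v t)"
    and f2: "\<And>v. v \<in> S \<Longrightarrow> continuous_on {a..b} (f v)"
    and fa: "\<And>v. v \<in> S \<Longrightarrow> 0 < f v a" and fb: "\<And>v. v \<in> S \<Longrightarrow> f v b < 0"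
    and s: "\<And>v. v \<in> S \<Longrightarrow> s v \<in> {a..b} \<and> f v (s v) = 0"
    and uniq: "\<And>v t. v \<in> S \<Longrightarrow> t \<in> {a..b} \<Longrightarrow> f v t = 0 \<Longrightarrow> t = s v"
  shows "continuous_on S s"
proof -
  have pos: "0 < f v t" if A: "v \<in> S" "a \<le> t" "t < s v" for v t
  proof (rule ccontr)
    assume "\<not> 0 < f v t"
    moreover have "continuous_on {a..t} (f v)"
      by (rule continuous_on_subset[OF f2]) (use A s[OF A(1)] in auto)
    ultimately obtain t' where "a \<le> t'" "t' \<le> t" "f v t' = 0"
      using IVT2'[of "f v" t 0 a] fa[OF A(1)] A(2) by auto
    then show False using uniq[OF A(1), of t'] s[OF A(1)] A by auto
  qed
  have neg: "f v t < 0" if A: "v \<in> S" "s v < t" "t \<le> b" for v t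
  proof (rule ccontr)
    assume "\<not> f v t < 0"
    moreover have "continuous_on {t..b} (f v)"
      by (rule continuous_on_subset[OF f2]) (use A s[OF A(1)] in auto)
    ultimately obtain t' where "t \<le> t'" "t' \<le> b" "f v t' = 0"
      using IVT2'[of "f v" b 0 t] fb[OF A(1)] A(3) by auto
    then show False using uniq[OF A(1), of t'] s[OF A(1)] A by auto
  qed
  have "(s \<longlongrightarrow> s v) (at v within S)" if v: "v \<in> S" for v
  proof (rule order_tendstoI)
    fix t assume t: "t < s v"
    show "\<forall>\<^sub>F u in at v within S. t < s u"
    proof (cases "t < a")
      case True
      have "\<forall>\<^sub>F u in at v within S. u \<in> S" by (simp add: eventually_at_filter)
      then show ?thesis by eventually_elim (use s True in force)
    next
      case False
      have tab: "t \<in> {a..b}" using False t s[OF v] by auto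
      have "((\<lambda>u. f u t) \<longlongrightarrow> f v t) (at v within S)" using f1[OF tab] v by (simp add: continuous_on_def)
      then have "\<forall>\<^sub>F u in at v within S. 0 < f u t"
        by (rule order_tendstoD) (use pos[OF v] False t in auto)
      moreover have "\<forall>\<^sub>F u in at v within S. u \<in> S" by (simp add: eventually_at_filter)
      ultimately show ?thesis
      proof eventually_elim
        case (elim u)
        then have "t \<noteq> s u" "\<not> s u < t" using s[of u] neg[of u t] tab by force+
        then show ?case by simp
      qed
    qed
  next
    fix t assume t: "s v < t"
    show "\<forall>\<^sub>F u in at v within S. s u < t"
    proof (cases "b < t")
      case True
      have "\<forall>\<^sub>F u in at v within S. u \<in> S" by (simp add: eventually_at_filter)
      then show ?thesis by eventually_elim (use s True in force)
    next
      case False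
      have tab: "t \<in> {a..b}" using False t s[OF v] by auto
      have "((\<lambda>u. f u t) \<longlongrightarrow> f v t) (at v within S)" using f1[OF tab] v by (simp add: continuous_on_def)
      then have "\<forall>\<^sub>F u in at v within S. f u t < 0"
        by (rule order_tendstoD) (use neg[OF v] False t in auto)
      moreover have "\<forall>\<^sub>F u in at v within S. u \<in> S" by (simp add: eventually_at_filter)
      ultimately show ?thesis
      proof eventually_elim
        case (elim u)
        then have "t \<noteq> s u" "\<not> t < s u" using s[of u] pos[of u t] tab by force+
        then show ?case by simp
      qed
    qed
  qed
  then show ?thesis by (simp add: continuous_on_def)
qed

text \<open>The end point conditions push the maximum into the interior, where it is critical.\<close>

lemma unique_critical_point_is_maximum:
  fixes \<alpha> :: "real \<Rightarrow> real"
  assumes "a < b" and diff: "\<And>t. t \<in> {a..b} \<Longrightarrow> (\<alpha> has_real_derivative \<alpha>' t) (at t)"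
    and ends: "0 < \<alpha>' a" "\<alpha>' b < 0"
    and uniq: "\<And>t. t \<in> {a..b} \<Longrightarrow> \<alpha>' t = 0 \<Longrightarrow> t = s"
    and t: "t \<in> {a..b}"
  shows "\<alpha> t \<le> \<alpha> s"
proof -
  have "continuous_on {a..b} \<alpha>"
    by (intro continuous_at_imp_continuous_on ballI DERIV_isCont[OF diff])
  then obtain m where m: "m \<in> {a..b}" and max: "\<And>t. t \<in> {a..b} \<Longrightarrow> \<alpha> t \<le> \<alpha> m"
    using continuous_attains_sup[of "{a..b}" \<alpha>] \<open>a < b\<close> by auto
  have "m \<noteq> a"
  proof
    assume "m = a"
    obtain d where d: "d > 0" "\<And>h. 0 < h \<Longrightarrow> h < d \<Longrightarrow> \<alpha> a < \<alpha> (a + h)"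
      using DERIV_pos_inc_right[OF diff ends(1)] \<open>a < b\<close> by auto
    define h where "h = min (d/2) (b - a)"
    have "0 < h" "h < d" "a + h \<in> {a..b}" using d(1) \<open>a < b\<close> by (auto simp: h_def)
    then show False using d(2)[of h] max[of "a + h"] \<open>m = a\<close> by auto
  qed
  moreover have "m \<noteq> b"
  proof
    assume "m = b"
    obtain d where d: "d > 0" "\<And>h. 0 < h \<Longrightarrow> h < d \<Longrightarrow> \<alpha> b < \<alpha> (b - h)"
      using DERIV_neg_dec_left[OF diff ends(2)] \<open>a < b\<close> by auto
    define h where "h = min (d/2) (b - a)"
    have "0 < h" "h < d" "b - h \<in> {a..b}" using d(1) \<open>a < b\<close> by (auto simp: h_def)
    then show False using d(2)[of h] max[of "b - h"] \<open>m = b\<close> by auto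
  qed
  ultimately have "a < m" "m < b" using m by auto
  have "\<alpha>' m = 0"
  proof (rule DERIV_local_max[OF diff[OF m], of "min (m - a) (b - m)"])
    show "\<forall>y. \<bar>m - y\<bar> < min (m - a) (b - m) \<longrightarrow> \<alpha> y \<le> \<alpha> m" by (auto intro!: max)
  qed (use \<open>a < m\<close> \<open>m < b\<close> in simp)
  with uniq[OF m] max[OF t] show ?thesis by simp
qed

lemma mean_value_segment:
  fixes E :: "'a::real_normed_vector \<Rightarrow> real"
  assumes E: "\<And>u. (E has_derivative blinfun_apply (E' u)) (at u)"
  shows "\<exists>z\<in>closed_segment x y. E y - E x = blinfun_apply (E' z) (y - x)"
proof -
  define h where "h t = E (x + t *\<^sub>R (y - x))" for t
  have h': "(h has_derivative (\<lambda>k. blinfun_apply (E' (x + t *\<^sub>R (y - x))) (k *\<^sub>R (y - x)))) (at t within {0..1})" for t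
  proof -
    have "((\<lambda>t. x + t *\<^sub>R (y - x)) has_derivative (\<lambda>k. k *\<^sub>R (y - x))) (at t within {0..1})"
      by (auto intro!: derivative_eq_intros)
    from has_derivative_compose[OF this E] show ?thesis by (simp add: h_def[abs_def])
  qed
  obtain t where t: "t \<in> {0<..<1}" "h 1 - h 0 = blinfun_apply (E' (x + t *\<^sub>R (y - x))) ((1 - 0) *\<^sub>R (y - x))"
    using mvt_simple[OF zero_less_one h'] by blast
  moreover have "x + t *\<^sub>R (y - x) \<in> closed_segment x y"
    using t(1) by (auto simp: in_segment algebra_simps intro!: exI[of _ t])
  ultimately show ?thesis by (auto simp: h_def)
qed

text \<open>
  Compare \<open>u = s v *\<^sub>R v\<close> with the Nehari point on the ray through \<open>q t = v + t *\<^sub>R w\<close>, which is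
  \<open>\<sigma> t *\<^sub>R q t\<close>. Minimality of \<open>v\<close> and maximality along the ray through \<open>v\<close> give
  \<open>E (\<sigma> t *\<^sub>R v) \<le> E (s v *\<^sub>R v) \<le> E (\<sigma> t *\<^sub>R q t)\<close>. The outer two points differ by a positive
  multiple of \<open>w\<close>, so the derivative in the direction \<open>w\<close> is nonnegative at a point between them,
  which tends to \<open>u\<close>. Comparing along \<open>\<sigma> t *\<^sub>R v\<close> rather than \<open>u\<close> removes the radial
  displacement, which continuity of \<open>s\<close> alone does not bound by a multiple of \<open>t\<close>. The strict
  bounds on \<open>s v\<close> keep \<open>\<sigma> t\<close> between \<open>r\<close> and \<open>R\<close> for small \<open>t\<close>.
\<close>

lemma minimax_stationary:
  fixes E :: "'a::real_normed_vector \<Rightarrow> real" and K :: "'a set"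
  defines "S \<equiv> K \<inter> sphere 0 1"
  assumes K: "convex K" "cone K"
    and E: "\<And>u. (E has_derivative blinfun_apply (E' u)) (at u)"
    and E': "continuous_on UNIV E'"
    and s: "continuous_on S s"
    and smax: "\<And>v t. v \<in> S \<Longrightarrow> t \<in> {r..R} \<Longrightarrow> E (t *\<^sub>R v) \<le> E (s v *\<^sub>R v)"
    and r: "0 \<le> r"
    and v: "v \<in> S" "r < s v" "s v < R"
    and min: "\<And>v'. v' \<in> S \<Longrightarrow> E (s v *\<^sub>R v) \<le> E (s v' *\<^sub>R v')"
    and w: "w \<in> K"
  shows "0 \<le> blinfun_apply (E' (s v *\<^sub>R v)) w"
proof (rule ccontr)
  let ?u = "s v *\<^sub>R v"
  assume "\<not> 0 \<le> blinfun_apply (E' ?u) w"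
  moreover have "((\<lambda>x. blinfun_apply (E' x) w) \<longlongrightarrow> blinfun_apply (E' ?u) w) (nhds ?u)"
    using E' by (intro tendsto_intros) (simp add: continuous_on_eq_continuous_at isCont_def tendsto_at_iff_tendsto_nhds)
  ultimately have "\<forall>\<^sub>F x in nhds ?u. blinfun_apply (E' x) w < 0"
    by (intro order_tendstoD) auto
  then obtain d where d: "0 < d" "\<And>x. dist x ?u < d \<Longrightarrow> blinfun_apply (E' x) w < 0"
    by (auto simp: eventually_nhds_metric)
  define q where "q t = v + t *\<^sub>R w" for t :: real
  define \<sigma> where "\<sigma> t = s (sgn (q t)) / norm (q t)" for t
  have nv: "norm v = 1" "v \<in> K" using v(1) by (auto simp: S_def)
  have q: "(q \<longlongrightarrow> v) (at_right 0)"
    unfolding q_def by (auto intro!: tendsto_eq_intros)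
  then have q0: "\<forall>\<^sub>F t in at_right 0. q t \<noteq> 0"
    using nv by (intro tendsto_imp_eventually_ne) auto
  have qK: "q t \<in> K" if "0 \<le> t" for t
    using K w nv that unfolding q_def by (metis cone_def convex_cone)
  have sgnS: "\<forall>\<^sub>F t in at_right 0. sgn (q t) \<in> S"
    using q0 eventually_at_right_less[of 0]
  proof eventually_elim
    case (elim t)
    then show ?case using qK[of t] K(2) by (auto simp: S_def norm_sgn sgn_div_norm cone_def)
  qed
  have sgnv: "sgn v = v" using nv by (simp add: sgn_div_norm)
  have "((\<lambda>t. sgn (q t)) \<longlongrightarrow> v) (at_right 0)"
    using tendsto_sgn[OF q] nv sgnv by force
  then have "((\<lambda>t. s (sgn (q t))) \<longlongrightarrow> s v) (at_right 0)"
    by (rule continuous_on_tendsto_compose[OF s _ v(1) sgnS])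
  from tendsto_divide[OF this tendsto_norm[OF q]] have \<sigma>: "(\<sigma> \<longlongrightarrow> s v) (at_right 0)"
    by (simp add: \<sigma>_def[abs_def] nv)
  have "((\<lambda>t. \<sigma> t *\<^sub>R v) \<longlongrightarrow> ?u) (at_right 0)" by (intro tendsto_intros \<sigma>)
  then have b1: "\<forall>\<^sub>F t in at_right 0. \<sigma> t *\<^sub>R v \<in> ball ?u d"
    using d(1) by (simp add: tendsto_iff dist_commute)
  have "((\<lambda>t. \<sigma> t *\<^sub>R q t) \<longlongrightarrow> ?u) (at_right 0)" by (intro tendsto_intros \<sigma> q)
  then have b2: "\<forall>\<^sub>F t in at_right 0. \<sigma> t *\<^sub>R q t \<in> ball ?u d"
    using d(1) by (simp add: tendsto_iff dist_commute)
  have "\<forall>\<^sub>F t in at_right 0. \<sigma> t *\<^sub>R v \<in> ball ?u d \<and> \<sigma> t *\<^sub>R q t \<in> ball ?u d \<and>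
      r < \<sigma> t \<and> \<sigma> t < R \<and> q t \<noteq> 0 \<and> sgn (q t) \<in> S \<and> 0 < t"
    by (intro eventually_conj b1 b2 order_tendstoD[OF \<sigma>] v q0 sgnS eventually_at_right_less)
  then obtain t where t: "\<sigma> t *\<^sub>R v \<in> ball ?u d" "\<sigma> t *\<^sub>R q t \<in> ball ?u d"
      "r < \<sigma> t" "\<sigma> t < R" "q t \<noteq> 0" "sgn (q t) \<in> S" "0 < t"
    using eventually_happens'[OF trivial_limit_at_right_real] by blast
  let ?x = "\<sigma> t *\<^sub>R v" and ?y = "\<sigma> t *\<^sub>R q t"
  have "s (sgn (q t)) *\<^sub>R sgn (q t) = ?y" using t by (simp add: \<sigma>_def sgn_div_norm divide_inverse)
  then have "E ?x \<le> E ?y"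
    using smax[OF v(1), of "\<sigma> t"] min[OF t(6)] t(3,4) by auto
  moreover
  obtain z where z: "z \<in> closed_segment ?x ?y" "E ?y - E ?x = blinfun_apply (E' z) (?y - ?x)"
    using mean_value_segment[of E E', OF E] by blast
  have "z \<in> ball ?u d" using z(1) t(1,2) convex_ball closed_segment_subset by blast
  then have "blinfun_apply (E' z) w < 0" using d(2) by (simp add: dist_commute)
  moreover have "?y - ?x = (\<sigma> t * t) *\<^sub>R w" by (simp add: q_def algebra_simps)
  moreover have "0 < \<sigma> t * t" using t(3,7) r by simp
  ultimately show False using z(2) mult_pos_neg[of "\<sigma> t * t" "blinfun_apply (E' z) w"]
    by (simp add: blinfun.scaleR_right)
qed

section \<open>Existence of a critical point in the Nehari set\<close>

text \<open>
  Strict monotonicity is tested on the pair \<open>u\<close>, \<open>T u\<close>: as \<open>J u - J (T u) = E' u\<close>, the pairing with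
  \<open>u - T u\<close> equals \<open>- E' u (T u)\<close>, the term \<open>E' u u\<close> being zero.
\<close>

lemma critical_point_if_nonneg_at_T:
  fixes J E' :: "'a::real_normed_vector \<Rightarrow> ('a \<Rightarrow>\<^sub>L real)"
  assumes "strictly_monotone J" "surj J"
    and u: "blinfun_apply (E' u) u = 0" "0 \<le> blinfun_apply (E' u) (T_operator J E' u)"
  shows "E' u = 0"
proof -
  let ?w = "T_operator J E' u"
  have Jw: "J ?w = J u - E' u"
    using assms(2) by (simp add: T_operator_def N_operator_def surj_f_inv_f)
  have "blinfun_apply (J u - J ?w) (u - ?w) = - blinfun_apply (E' u) ?w"
    using u(1) by (simp add: Jw blinfun.diff_right)
  then have "\<not> blinfun_apply (J u - J ?w) (u - ?w) > 0" using u(2) by simp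
  then have "u = ?w" using assms(1) unfolding strictly_monotone_def by blast
  with Jw show ?thesis by simp
qed

theorem theorem3p2:
  fixes \<phi> :: "real \<Rightarrow> real"
    and J :: "'a::banach \<Rightarrow> ('a \<Rightarrow>\<^sub>L real)"
    and K :: "'a set"
    and E :: "'a \<Rightarrow> real"
    and E' :: "'a \<Rightarrow> ('a \<Rightarrow>\<^sub>L real)"
    and r R :: real
  assumes "normalization_function \<phi>"
    and J_single_valued: "\<And>x. duality_mapping \<phi> x = {J x}"
    and "strictly_monotone J"
    and "bij J"
    and "continuous_on UNIV (inv J)"
    and "nondegenerate_cone K"
    and E_frechet: "\<And>u. (E has_derivative blinfun_apply (E' u)) (at u)"
    and E_C1: "continuous_on UNIV E'"
    and "0 < r" and "r < R"
    and H1: "completely_continuous (T_operator J E')" "T_operator J E' ` K \<subseteq> K"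
    and H2: "(INF u\<in>nehari_set E' K r R. norm (T_operator J E' u)) > 0"
    and H3: "\<And>u. u \<in> conical_shell K r R \<Longrightarrow>
       deriv (fibering_map E u) (r / norm u) > 0 \<and>
       deriv (fibering_map E u) (R / norm u) < 0 \<and>
       (\<exists>!s. s \<in> {r / norm u..R / norm u} \<and> deriv (fibering_map E u) s = 0)"
  shows "\<exists>u\<in>nehari_set E' K r R. E' u = 0"
proof -
  let ?T = "T_operator J E'"
  define S where "S = K \<inter> sphere 0 1"
  have K: "closed K" "convex K" "cone K" "K - {0} \<noteq> {}"
    using \<open>nondegenerate_cone K\<close> by (auto simp: nondegenerate_cone_def)
  have ray_K: "t *\<^sub>R v \<in> K" if "v \<in> S" "0 \<le> t" for t v
    using that K(3) by (auto simp: S_def cone_def)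
  have norm_S: "norm v = 1" if "v \<in> S" for v using that by (simp add: S_def)
  \<comment> \<open>The hypothesis on fibering maps, read off at \<open>r *\<^sub>R v\<close> and rescaled to unit vectors.\<close>
  have "\<forall>v\<in>S. \<exists>s\<in>{r..R}. 0 < E' (r *\<^sub>R v) v \<and> E' (R *\<^sub>R v) v < 0 \<and> E' (s *\<^sub>R v) v = 0 \<and>
      (\<forall>t\<in>{r..R}. E' (t *\<^sub>R v) v = 0 \<longrightarrow> t = s)"
  proof
    fix v assume v: "v \<in> S"
    let ?u = "r *\<^sub>R v"
    have "norm ?u = r" using norm_S[OF v] \<open>0 < r\<close> by simp
    moreover have "?u \<in> conical_shell K r R"
      using calculation ray_K[OF v] \<open>0 < r\<close> \<open>r < R\<close> by (simp add: conical_shell_def)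
    moreover have "deriv (fibering_map E ?u) t = r * E' ((t * r) *\<^sub>R v) v" for t
      by (simp add: deriv_fibering_map[of E E', OF E_frechet] blinfun.scaleR_right)
    ultimately have h: "0 < r * E' (r *\<^sub>R v) v" "r * E' (R *\<^sub>R v) v < 0"
        "\<exists>!s. s \<in> {1..R / r} \<and> E' ((s * r) *\<^sub>R v) v = 0"
      using H3[of ?u] \<open>0 < r\<close> by auto
    then obtain s where s: "s \<in> {1..R / r}" "E' ((s * r) *\<^sub>R v) v = 0"
      and uniq: "\<And>t. t \<in> {1..R / r} \<Longrightarrow> E' ((t * r) *\<^sub>R v) v = 0 \<Longrightarrow> t = s" by blast
    have "t = s * r" if "t \<in> {r..R}" "E' (t *\<^sub>R v) v = 0" for t
      using uniq[of "t / r"] that \<open>0 < r\<close> by (auto simp: field_simps)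
    then show "\<exists>s\<in>{r..R}. 0 < E' (r *\<^sub>R v) v \<and> E' (R *\<^sub>R v) v < 0 \<and> E' (s *\<^sub>R v) v = 0 \<and>
      (\<forall>t\<in>{r..R}. E' (t *\<^sub>R v) v = 0 \<longrightarrow> t = s)"
      using s h(1,2) \<open>0 < r\<close>
      by (intro bexI[of _ "s * r"]) (auto simp: field_simps zero_less_mult_iff mult_less_0_iff)
  qed
  then obtain s where "\<forall>v\<in>S. s v \<in> {r..R} \<and> 0 < E' (r *\<^sub>R v) v \<and> E' (R *\<^sub>R v) v < 0 \<and>
      E' (s v *\<^sub>R v) v = 0 \<and> (\<forall>t\<in>{r..R}. E' (t *\<^sub>R v) v = 0 \<longrightarrow> t = s v)"
    unfolding Bex_def bchoice_iff by blast
  then have s: "\<And>v. v \<in> S \<Longrightarrow> s v \<in> {r..R}"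
    and pos: "\<And>v. v \<in> S \<Longrightarrow> 0 < E' (r *\<^sub>R v) v" and neg: "\<And>v. v \<in> S \<Longrightarrow> E' (R *\<^sub>R v) v < 0"
    and zero: "\<And>v. v \<in> S \<Longrightarrow> E' (s v *\<^sub>R v) v = 0"
    and uniq: "\<And>v t. v \<in> S \<Longrightarrow> t \<in> {r..R} \<Longrightarrow> E' (t *\<^sub>R v) v = 0 \<Longrightarrow> t = s v"
    by blast+
  have cont_s: "continuous_on S s"
    by (rule continuous_on_transversal_zero[of r R S "\<lambda>v t. E' (t *\<^sub>R v) v"])
       (use s pos neg zero uniq in \<open>auto intro!: continuous_intros continuous_on_compose2[OF E_C1]\<close>)
  have nehari: "s v *\<^sub>R v \<in> nehari_set E' K r R" if "v \<in> S" for v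
    using s[OF that] zero[OF that] ray_K[OF that] norm_S[OF that] \<open>0 < r\<close>
    by (auto simp: nehari_set_def conical_shell_def blinfun.scaleR_right)
  have "\<exists>u\<in>nehari_set E' K r R. 0 \<le> E' u (?T u)"
  proof (cases "compact S")
    case True
    obtain k where "k \<in> K" "k \<noteq> 0" using K(4) by blast
    then have "sgn k \<in> S" using K(3) by (auto simp: S_def norm_sgn sgn_div_norm cone_def)
    moreover have "continuous_on UNIV E"
      using E_frechet by (meson continuous_at_imp_continuous_on has_derivative_continuous)
    then have "continuous_on S (\<lambda>v. E (s v *\<^sub>R v))"
      by (rule continuous_on_compose2) (auto intro!: continuous_intros cont_s)
    ultimately obtain v where v: "v \<in> S" and min: "\<And>v'. v' \<in> S \<Longrightarrow> E (s v *\<^sub>R v) \<le> E (s v' *\<^sub>R v')"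
      using continuous_attains_inf[OF True] by blast
    have ray_deriv: "((\<lambda>t. E (t *\<^sub>R v)) has_real_derivative E' (t *\<^sub>R v) v) (at t)" for v t
    proof -
      have "((\<lambda>t. t *\<^sub>R v) has_derivative (\<lambda>h. h *\<^sub>R v)) (at t)"
        by (auto intro!: derivative_eq_intros)
      from has_derivative_compose[OF this E_frechet] show ?thesis
        by (simp add: has_field_derivative_def blinfun.scaleR_right mult.commute[of _ "E' _ _"])
    qed
    have smax: "E (t *\<^sub>R v) \<le> E (s v *\<^sub>R v)" if "v \<in> S" "t \<in> {r..R}" for v t
      by (rule unique_critical_point_is_maximum[OF \<open>r < R\<close> ray_deriv pos[OF that(1)] neg[OF that(1)] uniq[OF that(1)] that(2)])
    have "s v \<noteq> r" "s v \<noteq> R" using pos[OF v] neg[OF v] zero[OF v] by auto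
    then have "r < s v" "s v < R" using s[OF v] by auto
    moreover have "?T (s v *\<^sub>R v) \<in> K"
      using H1(2) nehari[OF v] by (auto simp: nehari_set_def conical_shell_def)
    ultimately have "0 \<le> E' (s v *\<^sub>R v) (?T (s v *\<^sub>R v))"
      using minimax_stationary[OF K(2,3) E_frechet E_C1 cont_s[unfolded S_def], where v = v and r = r and R = R]
        smax v min \<open>0 < r\<close> unfolding S_def by auto
    then show ?thesis using nehari[OF v] by blast
  next
    case False
    define c where "c = (INF u\<in>nehari_set E' K r R. norm (?T u))"
    have "0 < c" using H2 by (simp add: c_def)
    have c: "c \<le> norm (?T u)" if "u \<in> nehari_set E' K r R" for u
      unfolding c_def using that by (intro cINF_lower bdd_belowI[of _ 0]) auto
    \<comment> \<open>Discarding \<open>ball 0 c\<close> keeps \<open>C\<close> away from the origin, so that \<open>sgn\<close> is continuous on it.\<close>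
    define C where "C = closure (?T ` cball 0 R) \<inter> (K \<inter> - ball 0 c)"
    define g where "g v = sgn (?T (s v *\<^sub>R v))" for v
    have contT: "continuous_on UNIV ?T" and "compact (closure (?T ` cball 0 R))"
      using H1(1) bounded_cball by (auto simp: completely_continuous_def)
    then have "compact C" unfolding C_def using K(1) by (intro compact_Int_closed closed_Int) auto
    have C0: "x \<noteq> 0" if "x \<in> C" for x using that \<open>0 < c\<close> by (auto simp: C_def)
    have TC: "?T (s v *\<^sub>R v) \<in> C" if "v \<in> S" for v
      using nehari[OF that] c[OF nehari[OF that]] H1(2) closure_subset[of "?T ` cball 0 R"]
      by (auto simp: C_def nehari_set_def conical_shell_def)
    have "\<exists>v\<in>S. g v = v"
      unfolding S_def
    proof (rule noncompact_cone_sphere_fixed_point[OF K(1-3)], fold S_def)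
      show "continuous_on S g" unfolding g_def
        by (intro continuous_on_sgn continuous_on_compose2[OF contT] continuous_intros cont_s)
           (use TC C0 in auto)
      show "g ` S \<subseteq> sgn ` C" using TC by (auto simp: g_def)
      show "sgn ` C \<subseteq> S" using C0 K(3) by (auto simp: S_def C_def norm_sgn sgn_div_norm cone_def)
      have "continuous_on C sgn" using continuous_on_sgn[OF continuous_on_id] C0 by auto
      then show "compact (sgn ` C)" using \<open>compact C\<close> by (rule compact_continuous_image)
    qed fact
    then obtain v where v: "v \<in> S" "sgn (?T (s v *\<^sub>R v)) = v" by (auto simp: g_def)
    then have "?T (s v *\<^sub>R v) = norm (?T (s v *\<^sub>R v)) *\<^sub>R v"
      using C0[OF TC[OF v(1)]] by (metis norm_eq_zero scaleR_one scaleR_scaleR sgn_div_norm right_inverse)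
    then have "E' (s v *\<^sub>R v) (?T (s v *\<^sub>R v)) = 0"
      using zero[OF v(1)] by (metis blinfun.scaleR_right scaleR_zero_right)
    then show ?thesis using nehari[OF v(1)] by (intro bexI[of _ "s v *\<^sub>R v"]) simp_all
  qed
  then obtain u where u: "u \<in> nehari_set E' K r R" "0 \<le> E' u (?T u)" by blast
  then have "E' u u = 0" by (simp add: nehari_set_def)
  then have "E' u = 0"
    using \<open>strictly_monotone J\<close> bij_is_surj[OF \<open>bij J\<close>] u(2) by (intro critical_point_if_nonneg_at_T)
  with u(1) show ?thesis by blast
qed

end
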